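(* Let $\mathbb{F}$ be a finite field, let $G$ be a finite simple graph, and let $H$ be the underlying graph of the line digraph $\delta G$. Then $\mathrm{minrk}_{\mathbb{F}}(\overline{H})\geq\sqrt{\tfrac12\cdot\log_{|\mathbb{F}|}\chi(G)}$.
   Context: For a graph (or digraph) $G$ on vertex set $[n]$ and a field $\mathbb{F}$, a matrix $M\in\mathbb{F}^{n\times n}$ represents $G$ if $M_{i,i}\neq0$ for all $i$ and $M_{i,j}=0$ for all distinct $i,j$ with $(i,j)$ not an edge (for an undirected graph each edge counts in both directions). $\mathrm{minrk}_{\mathbb{F}}(G)$ is the minimum rank over $\mathbb{F}$ of a matrix representing $G$. $\overline{H}$ is the complement graph and $\chi$ the chromatic number. The line digraph $\delta G$ has as vertices all ordered pairs $(x,y)$ with $\{x,y\}$ an edge of $G$, with a directed edge from $(x,y)$ to $(z,w)$ whenever $y=z$; $H$ is obtained by ignoring directions. *)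

theory Defs
  imports
    "HOL-Analysis.Analysis"
    "Graph_Theory.Digraph_Component"
    "Jordan_Normal_Form.DL_Rank"
begin

text \<open>
  Following the Graph_Theory library, a finite simple graph is a finite loop-free symmetric digraph
  without parallel arcs (\<^locale>\<open>pair_graph\<close>): an edge \<open>{x, y}\<close> is the pair of arcs
  \<open>(x, y)\<close>, \<open>(y, x)\<close>.  The underlying graph of a digraph is its symmetric closure
  \<^const>\<open>mk_symmetric\<close>.
\<close>

definition proper_coloring :: "'v pair_pre_digraph \<Rightarrow> nat \<Rightarrow> ('v \<Rightarrow> nat) \<Rightarrow> bool" where
  "proper_coloring G k c \<longleftrightarrow>
     (\<forall>x\<in>pverts G. c x < k) \<and> (\<forall>x y. (x, y) \<in> parcs G \<longrightarrow> c x \<noteq> c y)"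

definition chromatic_number :: "'v pair_pre_digraph \<Rightarrow> nat" where
  "chromatic_number G = (LEAST k. \<exists>c. proper_coloring G k c)"

definition complement_graph :: "'v pair_pre_digraph \<Rightarrow> 'v pair_pre_digraph" where
  "complement_graph G =
     \<lparr> pverts = pverts G,
       parcs = {(x, y). x \<in> pverts G \<and> y \<in> pverts G \<and> x \<noteq> y \<and> (x, y) \<notin> parcs G} \<rparr>"

text \<open>
  For a symmetric \<open>G\<close>, the arc set is exactly the set of ordered pairs \<open>(x, y)\<close> with \<open>{x, y}\<close> an
  edge, so every edge contributes two vertices to the line digraph.
\<close>

definition line_digraph :: "'v pair_pre_digraph \<Rightarrow> ('v \<times> 'v) pair_pre_digraph" where
  "line_digraph G =
     \<lparr> pverts = parcs G,
       parcs = {((x, y), (z, w)) | x y z w. (x, y) \<in> parcs G \<and> (z, w) \<in> parcs G \<and> y = z} \<rparr>"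

text \<open>
  Matrices are indexed by \<open>0, ..., n - 1\<close>, so the vertex set is identified with that range through
  an enumeration \<open>v\<close>.  Only finite vertex sets have one.
\<close>

definition represents ::
    "(nat \<Rightarrow> 'v) \<Rightarrow> 'f::field mat \<Rightarrow> 'v pair_pre_digraph \<Rightarrow> bool" where
  "represents v M G \<longleftrightarrow>
     (let n = card (pverts G) in
        bij_betw v {..<n} (pverts G) \<and>
        M \<in> carrier_mat n n \<and>
        (\<forall>i<n. M $$ (i, i) \<noteq> 0) \<and>
        (\<forall>i<n. \<forall>j<n. i \<noteq> j \<and> (v i, v j) \<notin> parcs G \<longrightarrow> M $$ (i, j) = 0))"

text \<open>
  Changing the enumeration permutes rows and columns simultaneously and preserves the rank, so the
  minimum over all enumerations equals the minimum for any fixed one.  The first argument of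
  \<^const>\<open>vec_space.rank\<close> is the number of rows.
\<close>

definition minrk :: "'f::field itself \<Rightarrow> 'v pair_pre_digraph \<Rightarrow> nat" where
  "minrk F G =
     (LEAST r. \<exists>v (M :: 'f mat). represents v M G \<and> vec_space.rank (card (pverts G)) M = r)"

end

theory Submission
  imports Defs
begin

text \<open>
  Let \<open>M\<close> represent the complement of \<open>H\<close> with rank \<open>r\<close>, and attach to a vertex \<open>x\<close> the set \<open>X x\<close> of
  the columns of \<open>M\<close> indexed by the arcs ending in \<open>x\<close>.  If \<open>(x, y)\<close> is an arc, the coordinate
  \<open>(x, y)\<close> vanishes on \<open>X x\<close>, hence on its span, but not on the column \<open>(x, y)\<close>, which belongs to
  \<open>X y\<close>.  So the spans of the sets \<open>X x\<close> properly colour \<open>G\<close>.  Each of them is generated by \<open>r\<close>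
  vectors of the column space of \<open>M\<close>, a set of size at most \<open>q ^ r\<close> for \<open>q\<close> the order of the field,
  which leaves at most \<open>q ^ (r\<^sup>2)\<close> colours.
\<close>

lemma chromatic_number_le_card:
  assumes "finite S" "\<And>x. x \<in> pverts G \<Longrightarrow> f x \<in> S"
    and "\<And>x y. (x, y) \<in> parcs G \<Longrightarrow> x \<in> pverts G \<and> y \<in> pverts G \<and> f x \<noteq> f y"
  shows "chromatic_number G \<le> card S"
proof -
  obtain h where h: "bij_betw h S {0..<card S}"
    using ex_bij_betw_finite_nat[OF assms(1)] by blast
  have "proper_coloring G (card S) (h \<circ> f)"
    unfolding proper_coloring_def
  proof (intro conjI ballI allI impI)
    fix x assume "x \<in> pverts G"
    then show "(h \<circ> f) x < card S"
      using h assms(2) by (auto simp: bij_betw_def)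
  next
    fix x y assume "(x, y) \<in> parcs G"
    then show "(h \<circ> f) x \<noteq> (h \<circ> f) y"
      using h assms(2,3) by (metis bij_betw_def comp_apply inj_on_contraD)
  qed
  then show ?thesis
    unfolding chromatic_number_def by (intro Least_le) blast
qed

text \<open>A maximal independent subset of \<open>X\<close> spans \<open>X\<close> and has at most
  \<open>rank A\<close> elements. Padding with zero vectors makes the length exactly
  \<open>rank A\<close>, whatever \<open>X\<close> is, so the lists obtained for different
  \<open>X\<close> can be counted together; hence \<open>0\<^sub>v n\<close> among the admissible
  entries.\<close>

lemma (in vec_space) spanning_list_length_rank:
  assumes A: "A \<in> carrier_mat n nc" and X: "X \<subseteq> set (cols A)"
  obtains l where "length l = rank A" "set l \<subseteq> insert (0\<^sub>v n) X" "X \<subseteq> span (set l)"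
proof -
  have XV: "X \<subseteq> carrier_vec n" and finX: "finite X"
    using cols_dim[of A] A X finite_subset by auto
  have "lin_indpt {}"
    unfolding lin_dep_def by auto
  then obtain U where finU: "finite U" and U: "maximal U (\<lambda>T. T \<subseteq> X \<and> lin_indpt T)"
    using maximal_exists_superset[of X "\<lambda>T. T \<subseteq> X \<and> lin_indpt T" "{}"] finX by auto
  have UX: "U \<subseteq> X" and Uli: "lin_indpt U"
    using U by (auto simp: maximal_def)
  have UV: "U \<subseteq> carrier_vec n"
    using UX XV by blast
  have rk: "card U \<le> rank A"
    using rank_ge_card_indpt[OF A _ Uli] UX X by blast
  have XU: "X \<subseteq> span U"
  proof
    fix u assume u: "u \<in> X"
    show "u \<in> span U"
    proof (rule ccontr)
      assume nin: "u \<notin> span U"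
      then have "u \<notin> U" using in_own_span[of U] UV by auto
      have "lin_indpt (U \<union> {u})"
        using lin_dep_iff_in_span[of U u] UV Uli u XV nin \<open>u \<notin> U\<close> by auto
      moreover have "U \<union> {u} \<subseteq> X" "U \<union> {u} \<supseteq> U"
        using UX u by auto
      ultimately have "U \<union> {u} = U"
        using U unfolding maximal_def by blast
      then show False using \<open>u \<notin> U\<close> by blast
    qed
  qed
  obtain k where k: "set k = U" "distinct k"
    using finite_distinct_list[OF finU] by blast
  define l where "l = k @ replicate (rank A - card U) (0\<^sub>v n)"
  have "length l = rank A"
    using rk distinct_card[OF k(2)] k(1) by (simp add: l_def)
  moreover have "set l \<subseteq> insert (0\<^sub>v n) X" "U \<subseteq> set l"
    using k UX by (auto simp: l_def)
  moreover have "X \<subseteq> span (set l)"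
    using XU span_is_monotone[OF calculation(3)] by blast
  ultimately show ?thesis using that by blast
qed

lemma (in vec_space) index_span_eq_0:
  fixes u :: "'a Matrix.vec" and U :: "'a Matrix.vec set"
  assumes "finite U" "U \<subseteq> carrier_vec n" "u \<in> span U" "i < n" "\<And>w. w \<in> U \<Longrightarrow> w $ i = 0"
  shows "u $ i = 0"
proof -
  obtain a where "u = lincomb a U"
    using assms(1-3) finite_span by auto
  then show ?thesis
    using lincomb_index[OF assms(4,2), of a] assms(5) by simp
qed

lemma card_column_space_le:
  fixes A :: "'f::{field,finite} mat"
  assumes A: "A \<in> carrier_mat n nc"
  defines "W \<equiv> LinearCombinations.module.span class_ring (module_vec TYPE('f) n) (set (cols A))"
  shows "finite W \<and> card W \<le> CARD('f) ^ vec_space.rank n A"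
proof -
  interpret vec_space "TYPE('f)" n .
  obtain l where l: "length l = rank A" "set l \<subseteq> insert (0\<^sub>v n) (set (cols A))"
    "set (cols A) \<subseteq> span (set l)"
    using spanning_list_length_rank[OF A, of "set (cols A)"] by blast
  have lV: "set l \<subseteq> carrier_vec n"
    using l(2) cols_dim[of A] A by auto
  have "W \<subseteq> span (set l)"
    unfolding W_def using span_is_subset[OF l(3) span_is_submodule] lV by auto
  \<comment> \<open>Coefficients are functions on all vectors; restricting them to
    \<open>set l\<close> leaves the linear combination unchanged and only finitely many functions to
    count.\<close>
  also have "\<dots> \<subseteq> (\<lambda>a. lincomb a (set l)) ` (set l \<rightarrow>\<^sub>E UNIV)"
  proof
    fix u assume "u \<in> span (set l)"
    then obtain a where "u = lincomb a (set l)"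
      using finite_span[of "set l"] lV by auto
    also have "\<dots> = lincomb (restrict a (set l)) (set l)"
      by (rule lincomb_cong) (use lV in auto)
    finally show "u \<in> (\<lambda>a. lincomb a (set l)) ` (set l \<rightarrow>\<^sub>E UNIV)"
      by (intro rev_image_eqI[where x = "restrict a (set l)"]) simp_all
  qed
  finally have sub: "W \<subseteq> (\<lambda>a. lincomb a (set l)) ` (set l \<rightarrow>\<^sub>E (UNIV :: 'f set))" .
  have fin: "finite (set l \<rightarrow>\<^sub>E (UNIV :: 'f set))"
    by (intro finite_PiE) auto
  have "card W \<le> card (set l \<rightarrow>\<^sub>E (UNIV :: 'f set))"
    using sub fin by (rule surj_card_le[rotated])
  also have "\<dots> = CARD('f) ^ card (set l)"
    by (simp add: card_PiE)
  also have "\<dots> \<le> CARD('f) ^ rank A"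
    using card_length[of l] l(1) by (intro power_increasing) (auto simp: Suc_le_eq)
  finally show ?thesis
    using finite_subset[OF sub] fin by blast
qed

text \<open>The identity matrix represents every graph on a finite vertex set, so the minimum is
  over a nonempty set of ranks.\<close>

lemma minrk_attained:
  fixes G :: "'v pair_pre_digraph"
  assumes "finite (pverts G)"
  obtains v and M :: "'f::field mat" where "represents v M G"
    "vec_space.rank (card (pverts G)) M = minrk TYPE('f) G"
proof -
  define n where "n = card (pverts G)"
  obtain v where "bij_betw v {..<n} (pverts G)"
    using ex_bij_betw_nat_finite[OF assms] by (auto simp: n_def atLeast0LessThan)
  then have "represents v (1\<^sub>m n :: 'f mat) G"
    by (auto simp: represents_def n_def Let_def)
  then have "\<exists>r v (M :: 'f mat). represents v M G \<and> vec_space.rank (card (pverts G)) M = r"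
    by blast
  from LeastI_ex[OF this] show ?thesis
    using that unfolding minrk_def by blast
qed

lemma chromatic_number_le_minrk:
  fixes G :: "'v pair_pre_digraph"
  assumes G: "pair_graph G" and H: "H = mk_symmetric (with_proj (line_digraph G))"
  shows "chromatic_number G
    \<le> CARD('f) ^ (minrk TYPE('f::{field,finite}) (complement_graph H))\<^sup>2"
proof -
  interpret pair_graph G by fact
  define n where "n = card (parcs G)"
  have verts: "pverts (complement_graph H) = parcs G"
    by (simp add: complement_graph_def H line_digraph_def)
  obtain v and M :: "'f mat" where rep: "represents v M (complement_graph H)"
    and rk: "vec_space.rank n M = minrk TYPE('f) (complement_graph H)"
    using minrk_attained[of "complement_graph H"] pair_finite_arcs unfolding verts n_def by blast
  interpret vec_space "TYPE('f)" n .
  have v: "bij_betw v {..<n} (parcs G)" and M: "M \<in> carrier_mat n n"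
    and diag: "\<And>i. i < n \<Longrightarrow> M $$ (i, i) \<noteq> 0"
    and off: "\<And>i j. i < n \<Longrightarrow> j < n \<Longrightarrow> i \<noteq> j \<Longrightarrow> (v i, v j) \<notin> parcs (complement_graph H)
      \<Longrightarrow> M $$ (i, j) = 0"
    using rep unfolding represents_def Let_def verts n_def by auto
  define X where "X x = col M ` {j. j < n \<and> snd (v j) = x}" for x
  have Xcols: "X x \<subseteq> set (cols M)" for x
    using M by (auto simp: X_def cols_def)
  \<comment> \<open>The colour of \<open>x\<close> will be a chosen generating list rather than its
    span: equal lists have equal spans, and lists of fixed length are counted directly.\<close>
  have "\<forall>x. \<exists>l. length l = rank M \<and> set l \<subseteq> insert (0\<^sub>v n) (X x) \<and> X x \<subseteq> span (set l)"
    using spanning_list_length_rank[OF M Xcols] by metis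
  then obtain f where f: "\<And>x. length (f x) = rank M" "\<And>x. set (f x) \<subseteq> insert (0\<^sub>v n) (X x)"
    "\<And>x. X x \<subseteq> span (set (f x))"
    by metis
  define W where "W = span (set (cols M))"
  have finW: "finite W" and cardW: "card W \<le> CARD('f) ^ rank M"
    using card_column_space_le[OF M] unfolding W_def by auto
  have colsV: "set (cols M) \<subseteq> carrier_vec n"
    using cols_dim[of M] M by auto
  \<comment> \<open>The padding entries must lie in \<open>W\<close> too.\<close>
  have "insert (0\<^sub>v n) (set (cols M)) \<subseteq> W"
    using in_own_span[of "set (cols M)"] colsV
      submodule.zero_closed[OF span_is_submodule[of "set (cols M)"]]
    unfolding W_def by auto
  then have fW: "set (f x) \<subseteq> W" for x
    using f(2)[of x] Xcols[of x] by blast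
  have sep: "f x \<noteq> f y" if xy: "(x, y) \<in> parcs G" for x y
  proof
    assume eq: "f x = f y"
    obtain i where i: "i < n" "v i = (x, y)"
      using v xy by (metis bij_betw_iff_bijections lessThan_iff)
    have zero: "w $ i = 0" if w: "w \<in> set (f x)" for w
    proof (cases "w = 0\<^sub>v n")
      case False
      then obtain j where j: "j < n" "snd (v j) = x" "w = col M j"
        using f(2)[of x] w by (auto simp: X_def)
      have vj: "v j \<in> parcs G"
        using v j(1) by (auto simp: bij_betw_def)
      \<comment> \<open>Diagonal entries of \<open>M\<close> are nonzero, so
        \<open>i \<noteq> j\<close> has to be secured: the arc \<open>v j\<close> ends in
        \<open>x\<close>, while \<open>v i\<close> ends in \<open>y\<close>.\<close>
      have "x \<noteq> y" using pair_no_loops[OF xy] by simp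
      then have "i \<noteq> j" using i(2) j(2) by (metis snd_conv)
      \<comment> \<open>\<open>v j\<close> ends where \<open>v i\<close> starts, so the line digraph
        has an arc from \<open>v j\<close> to \<open>v i\<close>; the symmetric closure supplies the
        reverse.\<close>
      moreover have "(v i, v j) \<in> parcs H"
        unfolding H parcs_mk_symmetric using vj xy i j
        by (cases "v j") (force simp: line_digraph_def)
      ultimately have "M $$ (i, j) = 0"
        using off i(1) j(1) by (auto simp: complement_graph_def)
      then show ?thesis using j M i by simp
    qed (use i in simp)
    have "col M i \<in> X y" using i by (auto simp: X_def)
    then have "col M i \<in> span (set (f x))" using f(3)[of y] eq by auto
    moreover have "set (f x) \<subseteq> carrier_vec n"
      using f(2)[of x] Xcols[of x] colsV by auto
    ultimately have "col M i $ i = 0"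
      using index_span_eq_0[OF finite_set _ _ i(1) zero] by blast
    then show False using diag i(1) M by simp
  qed
  have "chromatic_number G \<le> card {l. set l \<subseteq> W \<and> length l = rank M}"
    using sep f(1) fW finite_lists_length_eq[OF finW]
    by (intro chromatic_number_le_card[where f = f]) (auto dest: in_arcsD1 in_arcsD2)
  also have "\<dots> = card W ^ rank M"
    by (rule card_lists_length_eq[OF finW])
  also have "\<dots> \<le> (CARD('f) ^ rank M) ^ rank M"
    using cardW by (rule power_mono) simp
  finally show ?thesis
    by (simp add: rk power2_eq_square power_mult)
qed

theorem theorem3p13:
  fixes G :: "'v pair_pre_digraph"
    and H :: "('v \<times> 'v) pair_pre_digraph"
  assumes "pair_graph G"
    and "H = mk_symmetric (with_proj (line_digraph G))"
  shows "real (minrk TYPE('f::{field,finite}) (complement_graph H))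
           \<ge> sqrt (1 / 2 * log (real CARD('f)) (real (chromatic_number G)))"
proof -
  define r where "r = minrk TYPE('f) (complement_graph H)"
  let ?q = "real CARD('f)"
  have "card {0, 1 :: 'f} \<le> CARD('f)"
    by (intro card_mono) auto
  then have q: "?q > 1" by simp
  have "log ?q (chromatic_number G) \<le> real (r\<^sup>2)"
  \<comment> \<open>Monotonicity of \<open>log\<close> needs a positive argument; at 0 the value of
    \<open>log\<close> is 0 by convention.\<close>
  proof (cases "chromatic_number G = 0")
    case False
    have "log ?q (chromatic_number G) \<le> log ?q (?q ^ r\<^sup>2)"
      using chromatic_number_le_minrk[OF assms, where 'f = 'f] q False
      unfolding r_def by (subst log_le_cancel_iff) (auto simp flip: of_nat_power)
    also have "\<dots> = real (r\<^sup>2)"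
      using q by (simp add: log_nat_power)
    finally show ?thesis .
  qed (simp add: log_def)
  \<comment> \<open>Halving preserves an upper bound that is nonnegative.\<close>
  then have "1 / 2 * log ?q (chromatic_number G) \<le> (real r)\<^sup>2"
    using zero_le_power2[of "real r"] unfolding of_nat_power by linarith
  then show ?thesis
    unfolding r_def by (intro real_le_lsqrt) auto
qed

end
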